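(* Suppose that $r\in\mathbb N$ and $g\in\mathcal E$ satisfy $T^rg=g$. Then $g=h$.
   Context: "Decreasing" means non-increasing; $\int f:=\int_0^1 f(x)\,dx$. Let $\mathcal M$ be the set of measurable $f\colon[0,1]\to[0,\infty)$ with $\int f>0$, and $\mathcal E$ the set of decreasing $f\in\mathcal M$ with $f(0)=1$. For $g\in\mathcal E$ its pseudo-inverse is $g^*(y):=\sup\{x\in[0,1]: g(x)\ge y\}$ for $y\in[0,1]$; then $g^*\in\mathcal E$ and $\int g^*=\int g$. Define the operator $T$ on $\mathcal E$ by $(Tf)(x)=\frac{\int_x^1 f^*}{\int f}$ for $x\in[0,1]$, with iterates $T^n=T\circ T^{n-1}$, $T^0=\mathrm{id}$. Let $h_0\equiv1$ on $[0,1]$ and $h_n:=T^nh_0$. The sequence $(h_n)$ converges uniformly on $[0,1]$; let $h$ denote its limit (it satisfies $Th=h$). *)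

theory Defs
  imports "HOL-Analysis.Analysis"
begin

text \<open>Functions on [0,1] are modelled as real \<Rightarrow> real; only their values on [0,1] matter.\<close>

definition in_E :: "(real \<Rightarrow> real) \<Rightarrow> bool" where
  "in_E f \<longleftrightarrow>
     f \<in> borel_measurable (lebesgue_on {0..1}) \<and>
     (\<forall>x\<in>{0..1}. 0 \<le> f x) \<and>
     integral {0..1} f > 0 \<and>
     (\<forall>x\<in>{0..1}. \<forall>y\<in>{0..1}. x \<le> y \<longrightarrow> f y \<le> f x) \<and>
     f 0 = 1"

definition pinv :: "(real \<Rightarrow> real) \<Rightarrow> real \<Rightarrow> real" where
  "pinv g y = Sup {x \<in> {0..1}. g x \<ge> y}"

definition Top :: "(real \<Rightarrow> real) \<Rightarrow> real \<Rightarrow> real" where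
  "Top f x = integral {x..1} (pinv f) / integral {0..1} f"

definition hseq :: "nat \<Rightarrow> real \<Rightarrow> real" where
  "hseq n = (Top ^^ n) (\<lambda>_. 1)"

definition hlim :: "real \<Rightarrow> real" where
  "hlim x = lim (\<lambda>n. hseq n x)"

end

theory Submission
  imports Defs
begin

text \<open>
  Call \<open>f\<close> below \<open>g\<close> if \<open>g(x) - b f(x/a)\<close> never takes the signs minus, plus, minus in this
  order, for all \<open>a, b > 0\<close>. Inversion swaps the roles of \<open>a\<close> and \<open>b\<close>, and integrating tails
  cannot create sign changes, so \<open>Top\<close> preserves this relation. The constant function \<open>h\<^sub>0\<close> is
  below everything, hence \<open>h\<^sub>n\<close> is below \<open>h\<^sub>n\<^sub>+\<^sub>1\<close> and below all iterates \<open>g\<^sub>i\<close> of a periodic point.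
  This gives \<open>g\<^sub>i \<le> h\<^sub>n\<close> pointwise (so \<open>h\<^sub>n\<close> decreases to a limit \<open>h\<close>), and, by comparing slopes at
  the origin, \<open>h\<^sub>n\<^sub>+\<^sub>1(x) \<le> g\<^sub>i\<^sub>+\<^sub>1(x \<integral>g\<^sub>i / \<integral>h\<^sub>n)\<close>. In the limit \<open>h(x) \<le> g\<^sub>i\<^sub>+\<^sub>1(\<rho> x)\<close> with
  \<open>\<rho> = \<integral>g\<^sub>i / \<integral>h \<le> 1\<close>, and integrating this, \<open>\<integral>g\<^sub>i \<le> \<integral>g\<^sub>i\<^sub>+\<^sub>1\<close>. By periodicity these integrals
  agree, and the equality case forces \<open>\<rho> = 1\<close>, that is, \<open>h \<le> g\<^sub>i\<^sub>+\<^sub>1\<close>.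
\<close>

section \<open>Integrals of real functions\<close>

lemma integrable_on_antimono_on:
  fixes f :: "real \<Rightarrow> real"
  assumes "antimono_on {a..b} f"
  shows "f integrable_on {a..b}"
proof -
  have "mono_on {a..b} (\<lambda>x. - f x)"
    using assms by (auto simp: monotone_on_def)
  then have "(\<lambda>x. - f x) integrable_on {a..b}"
    by (rule integrable_on_mono_on)
  then show ?thesis
    by (simp add: integrable_neg_iff)
qed

lemma integral_neg_imp_ex_neg:
  fixes f :: "'a::euclidean_space \<Rightarrow> real"
  assumes "f integrable_on S" "integral S f < 0"
  shows "\<exists>x\<in>S. f x < 0"
  using integral_nonneg[OF assms(1)] assms(2) by (meson not_less)

lemma integral_pos_imp_ex_pos:
  fixes f :: "'a::euclidean_space \<Rightarrow> real"
  assumes "f integrable_on S" "0 < integral S f"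
  shows "\<exists>x\<in>S. 0 < f x"
  using integral_neg_imp_ex_neg[of "\<lambda>x. - f x" S] assms by (simp add: integrable_neg)

lemma integral_extend_upper:
  fixes p :: "real \<Rightarrow> 'b::banach"
  assumes "\<And>t. M < t \<Longrightarrow> p t = 0" "M \<le> N"
  shows "integral {u..N} p = integral {u..M} p"
proof -
  have "{t \<in> {u..N} - {u..M}. p t \<noteq> 0} = {}" "{t \<in> {u..M} - {u..N}. p t \<noteq> 0} = {}"
    using assms by force+
  then show ?thesis
    by (intro integral_spike_set) (simp_all only: negligible_empty)
qed

lemma image_divide_inverse_atLeastAtMost:
  fixes a :: real
  assumes "0 < a"
  shows "(\<lambda>x. x / (1 / a)) ` {u / a..v / a} = {u..v}"
  using assms by (subst image_divide_atLeastAtMost) (auto simp: field_simps)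

lemma integral_rescale:
  fixes p :: "real \<Rightarrow> 'b::real_normed_vector"
  assumes "0 < a"
  shows "integral {u..v} (\<lambda>t. p (t / a)) = a *\<^sub>R integral {u / a..v / a} p"
  using integral_stretch_real[of "1 / a" "u / a" "v / a" p]
    image_divide_inverse_atLeastAtMost[OF assms, of u v] assms by simp

lemma integrable_rescale:
  fixes p :: "real \<Rightarrow> 'b::real_normed_vector"
  assumes "0 < a" "p integrable_on {u / a..v / a}"
  shows "(\<lambda>t. p (t / a)) integrable_on {u..v}"
  using integrable_stretch_real[OF assms(2), of "1 / a"]
    image_divide_inverse_atLeastAtMost[OF assms(1), of u v] assms(1) by simp

lemma isCont_less_imp_ex_greater:
  fixes f :: "real \<Rightarrow> real"
  assumes "isCont f x" "f x < c"
  shows "\<exists>y>x. f y < c"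
proof -
  have "\<forall>\<^sub>F y in at_right x. f y < c"
    using order_tendstoD(2)[OF isContD[OF assms(1)] assms(2)] by (simp add: eventually_at_split)
  moreover have "\<forall>\<^sub>F y in at_right x. x < y"
    by (simp add: eventually_at_right_less)
  ultimately have "\<forall>\<^sub>F y in at_right x. x < y \<and> f y < c"
    by eventually_elim auto
  then show ?thesis
    using eventually_happens'[OF trivial_limit_at_right_real] by blast
qed

section \<open>Pseudo-inverses\<close>

lemma in_E_antimono_on: "in_E f \<Longrightarrow> antimono_on {0..1} f"
  by (auto simp: in_E_def monotone_on_def)

lemma in_E_bounds:
  assumes "in_E f" "0 \<le> x" "x \<le> 1"
  shows "0 \<le> f x" "f x \<le> 1"
  using assms monotone_onD[OF in_E_antimono_on[OF assms(1)], of 0 x] by (auto simp: in_E_def)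

lemma in_E_integrable: "in_E f \<Longrightarrow> f integrable_on {0..1}"
  by (intro integrable_on_antimono_on in_E_antimono_on)

lemma in_E_integral_pos: "in_E f \<Longrightarrow> 0 < integral {0..1} f"
  by (simp add: in_E_def)

lemma in_E_continuousI:
  assumes cont: "continuous_on {0..1} f" and anti: "antimono_on {0..1} f" and "f 0 = 1" "0 \<le> f 1"
  shows "in_E f"
proof -
  have nonneg: "0 \<le> f x" if "x \<in> {0..1}" for x
    using monotone_onD[OF anti, of x 1] assms(4) that by auto
  have "integral {0..1} f \<noteq> 0"
    using integral_eq_0_iff[OF cont _ nonneg] assms(3) by auto
  moreover have "0 \<le> integral {0..1} f"
    using nonneg cont by (intro integral_nonneg integrable_continuous_interval)
  ultimately show ?thesis
    using assms nonneg continuous_imp_measurable_on_sets_lebesgue[OF cont]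
    by (auto simp: in_E_def monotone_on_def)
qed

lemma in_E_one: "in_E (\<lambda>_. 1)"
  by (rule in_E_continuousI) (auto simp: monotone_on_def)

lemma pinv_ge: "0 \<le> x \<Longrightarrow> x \<le> 1 \<Longrightarrow> y \<le> f x \<Longrightarrow> x \<le> pinv f y"
  unfolding pinv_def by (rule cSup_upper) (auto intro: bdd_aboveI[of _ 1])

lemma pinv_le:
  assumes "in_E f" "0 \<le> x" "x \<le> 1" "y \<le> 1" "f x < y"
  shows "pinv f y \<le> x"
  unfolding pinv_def
proof (rule cSup_least)
  show "{x \<in> {0..1}. y \<le> f x} \<noteq> {}"
    using assms by (auto simp: in_E_def intro!: exI[of _ 0])
  show "t \<le> x" if "t \<in> {x \<in> {0..1}. y \<le> f x}" for t
    using that assms monotone_onD[OF in_E_antimono_on[OF assms(1)], of x t] by (cases "t \<le> x") auto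
qed

lemma pinv_bounds:
  assumes "in_E f" "y \<le> 1"
  shows "0 \<le> pinv f y" "pinv f y \<le> 1"
proof -
  show "0 \<le> pinv f y"
    using assms by (intro pinv_ge) (auto simp: in_E_def)
  show "pinv f y \<le> 1"
    unfolding pinv_def
    by (rule cSup_least) (use assms in \<open>auto simp: in_E_def intro!: exI[of _ 0]\<close>)
qed

lemma pinv_antimono:
  assumes "in_E f" "y \<le> z" "z \<le> 1"
  shows "pinv f z \<le> pinv f y"
  unfolding pinv_def
  by (rule cSup_subset_mono)
    (use assms in \<open>auto simp: in_E_def intro!: bdd_aboveI[of _ 1] exI[of _ 0]\<close>)

text \<open>Beyond 1, \<open>pinv f\<close> is the supremum of the empty set, an unspecified value.\<close>

definition pinv0 :: "(real \<Rightarrow> real) \<Rightarrow> real \<Rightarrow> real" where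
  "pinv0 f y = (if y \<le> 1 then pinv f y else 0)"

lemma pinv0_eq_0: "1 < y \<Longrightarrow> pinv0 f y = 0"
  by (simp add: pinv0_def)

lemma pinv0_bounds:
  assumes "in_E f"
  shows "0 \<le> pinv0 f y" "pinv0 f y \<le> 1"
  using pinv_bounds[OF assms, of y] by (auto simp: pinv0_def)

lemma pinv0_antimono: "in_E f \<Longrightarrow> antimono_on A (pinv0 f)"
  using pinv_antimono[of f] pinv_bounds[of f] by (auto simp: monotone_on_def pinv0_def)

lemma pinv0_integrable: "in_E f \<Longrightarrow> pinv0 f integrable_on {a..b}"
  by (intro integrable_on_antimono_on pinv0_antimono)

lemma pinv0_one: "pinv0 (\<lambda>_. 1) y = (if y \<le> 1 then 1 else 0)"
  using pinv_ge[of 1 y "\<lambda>_. 1"] pinv_bounds(2)[OF in_E_one, of y] by (auto simp: pinv0_def)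

lemma pinv0_pos:
  assumes in_E_f: "in_E f" and cont: "continuous_on {0..1} f" and "y < 1"
  shows "0 < pinv0 f y"
proof -
  have "(f \<longlongrightarrow> 1) (at_right 0)"
    using continuous_on_Icc_at_rightD[OF cont] in_E_f by (simp add: in_E_def)
  then have "\<forall>\<^sub>F x in at_right 0. y < f x"
    using \<open>y < 1\<close> by (rule order_tendstoD)
  moreover have "\<forall>\<^sub>F x in at_right (0::real). x \<in> {0<..<1}"
    by (intro eventually_at_right_real) simp
  ultimately have "\<forall>\<^sub>F x in at_right 0. x \<in> {0<..<1} \<and> y < f x"
    by eventually_elim auto
  then have "\<exists>x. x \<in> {0<..<1} \<and> y < f x"
    by (rule eventually_happens'[OF trivial_limit_at_right_real])
  then obtain x where "0 < x" "x < 1" "y < f x"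
    by auto
  then show ?thesis
    using pinv_ge[of x y f] \<open>y < 1\<close> by (simp add: pinv0_def)
qed

definition undergraph :: "real set \<Rightarrow> (real \<Rightarrow> real) \<Rightarrow> (real \<times> real) set" where
  "undergraph S f = {(x, y). x \<in> S \<and> 0 \<le> y \<and> y \<le> f x}"

lemma undergraph_antimono_measurable:
  assumes "antimono_on {a..b} f"
  shows "undergraph {a..b} f \<in> sets (lborel \<Otimes>\<^sub>M lborel)"
proof -
  have "mono_on {a..b} (\<lambda>x. - f x)"
    using assms by (auto simp: monotone_on_def)
  then have "(\<lambda>x. - (- f x)) \<in> borel_measurable (restrict_space borel {a..b})"
    by (intro borel_measurable_uminus borel_measurable_mono_on_fnc)
  then have [measurable]: "(\<lambda>x. if x \<in> {a..b} then f x else -1) \<in> borel_measurable borel"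
    by (subst measurable_If_restrict_space_iff) (simp_all del: atLeastAtMost_iff)
  have "{z \<in> space (borel \<Otimes>\<^sub>M borel). 0 \<le> snd z \<and>
      snd z \<le> (if fst z \<in> {a..b} then f (fst z) else -1)} \<in> sets (borel \<Otimes>\<^sub>M borel)"
    by measurable
  moreover have "undergraph {a..b} f = {z \<in> space (borel \<Otimes>\<^sub>M borel). 0 \<le> snd z \<and>
      snd z \<le> (if fst z \<in> {a..b} then f (fst z) else -1)}"
    by (auto simp: undergraph_def space_pair_measure split: if_splits)
  ultimately show ?thesis
    by (simp add: space_pair_measure cong: sets_pair_measure_cong)
qed

lemma emeasure_undergraph:
  assumes anti: "antimono_on {a..b} f" and nonneg: "\<And>x. x \<in> {a..b} \<Longrightarrow> 0 \<le> f x"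
  shows "emeasure (lborel \<Otimes>\<^sub>M lborel) (undergraph {a..b} f) = ennreal (integral {a..b} f)"
proof -
  have vertical_section: "emeasure lborel (Pair x -` undergraph {a..b} f) =
      ennreal (indicator {a..b} x * f x)" for x
  proof -
    have "Pair x -` undergraph {a..b} f = (if x \<in> {a..b} then {0..f x} else {})"
      by (auto simp: undergraph_def)
    then show ?thesis
      using nonneg[of x] by auto
  qed
  have "emeasure (lborel \<Otimes>\<^sub>M lborel) (undergraph {a..b} f) =
      (\<integral>\<^sup>+x. ennreal (indicator {a..b} x * f x) \<partial>lborel)"
    by (simp add: lborel.emeasure_pair_measure_alt[OF undergraph_antimono_measurable[OF anti]]
        vertical_section)
  also have "\<dots> = ennreal (integral {a..b} f)"
    using nonneg integrable_integral[OF integrable_on_antimono_on[OF anti]]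
    by (rule nn_integral_has_integral_lebesgue)
  finally show ?thesis .
qed

lemma emeasure_undergraph_horizontal_section:
  assumes in_E_f: "in_E f"
  shows "emeasure lborel ((\<lambda>x. (x, y)) -` undergraph {0..1} f) =
    ennreal (indicator {0..1} y * pinv0 f y)"
proof (cases "y \<in> {0..1}")
  case True
  let ?S = "(\<lambda>x. (x, y)) -` undergraph {0..1} f"
  have lower: "{0..<pinv0 f y} \<subseteq> ?S"
  proof
    fix x assume x: "x \<in> {0..<pinv0 f y}"
    then have "\<not> f x < y"
      using pinv_le[OF in_E_f, of x y] pinv0_bounds[OF in_E_f, of y] True by (auto simp: pinv0_def)
    then show "x \<in> ?S"
      using x True pinv0_bounds[OF in_E_f, of y] by (auto simp: undergraph_def)
  qed
  have upper: "?S \<subseteq> {0..pinv0 f y}"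
    using pinv_ge[of _ y f] True by (auto simp: undergraph_def pinv0_def)
  have "?S \<in> sets lborel"
    using measurable_sets[OF measurable_Pair2'[of y lborel lborel]
        undergraph_antimono_measurable[OF in_E_antimono_on[OF in_E_f]]] by simp
  then have "emeasure lborel {0..<pinv0 f y} \<le> emeasure lborel ?S"
    by (rule emeasure_mono[OF lower])
  moreover have "emeasure lborel ?S \<le> emeasure lborel {0..pinv0 f y}"
    by (rule emeasure_mono[OF upper]) simp
  ultimately show ?thesis
    using pinv0_bounds[OF in_E_f, of y] True by simp
next
  case False
  then have "(\<lambda>x. (x, y)) -` undergraph {0..1} f = {}"
    using in_E_bounds(2)[OF in_E_f] by (fastforce simp: undergraph_def intro: order_trans)
  then show ?thesis
    using False by simp
qed

lemma integral_pinv0: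
  assumes in_E_f: "in_E f"
  shows "integral {0..1} (pinv0 f) = integral {0..1} f"
proof -
  note undergraph_measurable = undergraph_antimono_measurable[OF in_E_antimono_on[OF in_E_f]]
  have "ennreal (integral {0..1} f) = emeasure (lborel \<Otimes>\<^sub>M lborel) (undergraph {0..1} f)"
    using emeasure_undergraph[OF in_E_antimono_on[OF in_E_f]] in_E_bounds(1)[OF in_E_f] by simp
  also have "\<dots> = (\<integral>\<^sup>+y. ennreal (indicator {0..1} y * pinv0 f y) \<partial>lborel)"
    by (simp add: lborel_pair.emeasure_pair_measure_alt2[OF undergraph_measurable]
        emeasure_undergraph_horizontal_section[OF in_E_f])
  also have "\<dots> = ennreal (integral {0..1} (pinv0 f))"
    using pinv0_bounds(1)[OF in_E_f] integrable_integral[OF pinv0_integrable[OF in_E_f]]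
    by (rule nn_integral_has_integral_lebesgue)
  finally show ?thesis
    using pinv0_bounds(1)[OF in_E_f] in_E_integral_pos[OF in_E_f]
    by (simp add: integral_nonneg pinv0_integrable[OF in_E_f])
qed

section \<open>The operator and profiles\<close>

lemma Top_pinv0: "Top f x = integral {x..1} (pinv0 f) / integral {0..1} f"
  unfolding Top_def by (auto simp: pinv0_def intro!: arg_cong2[where f="(/)"] integral_cong)

lemma Top_cong:
  assumes "\<And>x. x \<in> {0..1} \<Longrightarrow> f x = g x"
  shows "Top f = Top g"
proof -
  have "{x \<in> {0..1}. y \<le> f x} = {x \<in> {0..1}. y \<le> g x}" for y
    using assms by auto
  then have "pinv f = pinv g"
    by (simp add: pinv_def[abs_def])
  moreover have "integral {0..1} f = integral {0..1} g"
    using assms by (intro integral_cong)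
  ultimately show ?thesis
    by (simp add: Top_def[abs_def])
qed

lemma Top_eq_0: "1 \<le> x \<Longrightarrow> Top f x = 0"
  by (cases "x = 1") (auto simp: Top_def)

lemma Top_0: "in_E f \<Longrightarrow> Top f 0 = 1"
  using in_E_integral_pos[of f] by (simp add: Top_pinv0 integral_pinv0)

lemma Top_diff:
  assumes "in_E f" "x \<le> y" "y \<le> 1"
  shows "Top f x - Top f y = integral {x..y} (pinv0 f) / integral {0..1} f"
proof -
  have "integral {x..1} (pinv0 f) - integral {y..1} (pinv0 f) = integral {x..y} (pinv0 f)"
    using Henstock_Kurzweil_Integration.integral_combine
        [OF assms(2,3) pinv0_integrable[OF assms(1)]]
    by simp
  then show ?thesis
    by (simp add: Top_pinv0 flip: diff_divide_distrib)
qed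

lemma Top_antimono_on:
  assumes "in_E f"
  shows "antimono_on {0..1} (Top f)"
proof (rule monotone_onI)
  fix x y :: real
  assume xy: "x \<in> {0..1}" "y \<in> {0..1}" "x \<le> y"
  have "0 \<le> integral {x..y} (pinv0 f) / integral {0..1} f"
    using assms
    by (intro divide_nonneg_pos integral_nonneg pinv0_integrable in_E_integral_pos pinv0_bounds)
  then show "Top f y \<le> Top f x"
    using Top_diff[OF assms xy(3)] xy by simp
qed

lemma Top_continuous_on:
  assumes "in_E f"
  shows "continuous_on {0..1} (Top f)"
proof -
  have "continuous_on {0..1} (\<lambda>x. integral {x..1} (pinv0 f) / integral {0..1} f)"
    using in_E_integral_pos[OF assms]
    by (intro continuous_intros indefinite_integral_continuous_1' pinv0_integrable assms) auto
  then show ?thesis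
    by (simp add: Top_pinv0[abs_def])
qed

lemma in_E_Top: "in_E f \<Longrightarrow> in_E (Top f)"
  by (rule in_E_continuousI) (auto simp: Top_continuous_on Top_antimono_on Top_0 Top_eq_0)

definition profile :: "(real \<Rightarrow> real) \<Rightarrow> bool" where
  "profile f \<longleftrightarrow> continuous_on {0..1} f \<and> strict_antimono_on {0..1} f \<and> f 0 = 1 \<and> (\<forall>x\<ge>1. f x = 0)"

lemma profile_continuous_on: "profile f \<Longrightarrow> continuous_on {0..1} f"
  by (simp add: profile_def)

lemma profile_0: "profile f \<Longrightarrow> f 0 = 1"
  by (simp add: profile_def)

lemma profile_eq_0: "profile f \<Longrightarrow> 1 \<le> x \<Longrightarrow> f x = 0"
  by (simp add: profile_def)

lemma profile_less: "profile f \<Longrightarrow> 0 \<le> x \<Longrightarrow> x < y \<Longrightarrow> y \<le> 1 \<Longrightarrow> f y < f x"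
  by (auto simp: profile_def monotone_on_def)

lemma profile_isCont: "profile f \<Longrightarrow> 0 < x \<Longrightarrow> x < 1 \<Longrightarrow> isCont f x"
  by (intro continuous_on_interior[of "{0..1}"] profile_continuous_on) auto

lemma profile_in_E:
  assumes "profile f"
  shows "in_E f"
proof (rule in_E_continuousI)
  show "antimono_on {0..1} f"
    using profile_less[OF assms] by (force simp: monotone_on_def le_less)
qed (use assms in \<open>auto simp: profile_def\<close>)

lemma profile_bounds:
  assumes "profile f" "0 \<le> x"
  shows "0 \<le> f x" "f x \<le> 1"
  using in_E_bounds[OF profile_in_E[OF assms(1)] assms(2)] profile_eq_0[OF assms(1)]
  by (cases "x \<le> 1"; auto)+

lemma profile_pos: "profile f \<Longrightarrow> 0 \<le> x \<Longrightarrow> x < 1 \<Longrightarrow> 0 < f x"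
  using profile_less[of f x 1] profile_eq_0[of f 1] by simp

lemma profile_integral_initial_less:
  assumes profile_f: "profile f" and u: "0 \<le> u" "u < 1"
  shows "integral {0..u} f < integral {0..1} f"
proof -
  have "integral {u..1} (\<lambda>_. 0) < integral {u..1} f"
    using u profile_pos[OF profile_f] continuous_on_subset[OF profile_continuous_on[OF profile_f]]
    by (intro integral_less_real) auto
  then show ?thesis
    using Henstock_Kurzweil_Integration.integral_combine[of 0 u 1 f] u
      in_E_integrable[OF profile_in_E[OF profile_f]] by simp
qed

lemma profile_Top:
  assumes in_E_f: "in_E f" and cont: "continuous_on {0..1} f"
  shows "profile (Top f)"
proof -
  have "Top f y < Top f x" if xy: "0 \<le> x" "x < y" "y \<le> 1" for x y
  proof -
    obtain m where m: "x < m" "m < y"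
      using dense[OF xy(2)] by auto
    have "0 < (m - x) * pinv0 f m"
      using m xy pinv0_pos[OF in_E_f cont] by simp
    also have "\<dots> = integral {x..m} (\<lambda>_. pinv0 f m)"
      using m by simp
    also have "\<dots> \<le> integral {x..m} (pinv0 f)"
      using monotone_onD[OF pinv0_antimono[OF in_E_f, of UNIV]]
      by (intro integral_le pinv0_integrable[OF in_E_f]) auto
    finally have "0 < Top f x - Top f m"
      using m xy in_E_integral_pos[OF in_E_f] by (simp add: Top_diff[OF in_E_f])
    then show ?thesis
      using monotone_onD[OF Top_antimono_on[OF in_E_f], of m y] m xy by simp
  qed
  then show ?thesis
    using in_E_f by (auto simp: profile_def monotone_on_def Top_continuous_on Top_0 Top_eq_0)
qed

lemma pinv0_apply_profile:
  assumes profile_f: "profile f" and x: "x \<in> {0..1}"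
  shows "pinv0 f (f x) = x"
proof -
  have "pinv f (f x) = x"
    unfolding pinv_def
  proof (rule cSup_eq_maximum)
    show "t \<le> x" if "t \<in> {t \<in> {0..1}. f x \<le> f t}" for t
      using that x profile_less[OF profile_f, of x t] by (cases "t \<le> x") auto
  qed (use x in auto)
  then show ?thesis
    using profile_bounds[OF profile_f] x by (simp add: pinv0_def)
qed

lemma profile_image_Icc:
  assumes profile_f: "profile f"
  shows "f ` {0..1} = {0..1}"
proof
  show "f ` {0..1} \<subseteq> {0..1}"
    using profile_bounds[OF profile_f] by auto
  show "{0..1} \<subseteq> f ` {0..1}"
  proof
    fix y :: real
    assume "y \<in> {0..1}"
    then have "\<exists>x. 0 \<le> x \<and> x \<le> 1 \<and> f x = y"
      using profile_f by (intro IVT2') (auto simp: profile_def)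
    then show "y \<in> f ` {0..1}"
      by auto
  qed
qed

lemma profile_apply_pinv0:
  assumes profile_f: "profile f" and "0 \<le> y"
  shows "f (pinv0 f y) = min y 1"
proof (cases "y \<le> 1")
  case True
  then obtain x where "x \<in> {0..1}" "y = f x"
    using assms profile_image_Icc[OF profile_f] by (metis atLeastAtMost_iff imageE)
  then show ?thesis
    using pinv0_apply_profile[OF profile_f] True by simp
qed (simp add: pinv0_def profile_0[OF profile_f])

lemma pinv0_continuous_on:
  assumes profile_f: "profile f"
  shows "continuous_on {0..1} (pinv0 f)"
  using continuous_on_inv[OF profile_continuous_on[OF profile_f], of "pinv0 f"]
    pinv0_apply_profile[OF profile_f]
  by (simp add: profile_image_Icc[OF profile_f])

lemma less_pinv0_imp_less:
  assumes profile_f: "profile f" and "0 \<le> u" "0 \<le> w" "w < pinv0 f u"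
  shows "u < f w"
proof -
  have "min u 1 < f w"
    using profile_less[OF profile_f assms(3,4)] pinv0_bounds[OF profile_in_E[OF profile_f]]
      profile_apply_pinv0[OF profile_f assms(2)]
    by simp
  then show ?thesis
    using profile_bounds(2)[OF profile_f assms(3)] by simp
qed

lemma pinv0_less_imp_less:
  assumes profile_f: "profile f" and "0 < u" "pinv0 f u < w"
  shows "f w < u"
proof (cases "w \<le> 1")
  case True
  then have "f w < f (pinv0 f u)"
    using profile_less[OF profile_f _ assms(3)] pinv0_bounds(1)[OF profile_in_E[OF profile_f]]
    by simp
  also have "\<dots> = min u 1"
    using \<open>0 < u\<close> by (simp add: profile_apply_pinv0[OF profile_f])
  finally have "f w < min u 1" .
  then show ?thesis
    by simp
qed (use assms profile_eq_0[OF profile_f] in simp)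

lemma Top_has_real_derivative_0:
  assumes profile_f: "profile f"
  shows "(Top f has_real_derivative - (1 / integral {0..1} f)) (at_right 0)"
proof -
  have "((\<lambda>x. integral {x..1} (pinv0 f)) has_real_derivative - pinv0 f 0) (at 0 within {0..1})"
    by (intro integral_has_real_derivative' pinv0_continuous_on profile_f) simp
  moreover have "pinv0 f 0 = 1"
    using pinv0_apply_profile[OF profile_f, of 1] profile_eq_0[OF profile_f, of 1] by simp
  ultimately have "((\<lambda>x. integral {x..1} (pinv0 f) / integral {0..1} f) has_real_derivative
      - 1 / integral {0..1} f) (at 0 within {0..1})"
    by (intro DERIV_cdivide) simp
  then show ?thesis
    by (simp add: Top_pinv0[abs_def] at_within_Icc_at_right)
qed

section \<open>The shape order\<close>

definition humpless_on :: "'a::linorder set \<Rightarrow> ('a \<Rightarrow> real) \<Rightarrow> bool" where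
  "humpless_on S d \<longleftrightarrow>
     (\<forall>x\<in>S. \<forall>y\<in>S. \<forall>z\<in>S. x < y \<longrightarrow> y < z \<longrightarrow> d x < 0 \<longrightarrow> 0 < d y \<longrightarrow> 0 \<le> d z)"

lemma humpless_onI:
  assumes "\<And>x y z. x \<in> S \<Longrightarrow> y \<in> S \<Longrightarrow> z \<in> S \<Longrightarrow> x < y \<Longrightarrow> y < z \<Longrightarrow>
    d x < 0 \<Longrightarrow> 0 < d y \<Longrightarrow> d z < 0 \<Longrightarrow> False"
  shows "humpless_on S d"
  using assms unfolding humpless_on_def by (meson not_less)

lemma humpless_onD:
  "humpless_on S d \<Longrightarrow> x \<in> S \<Longrightarrow> y \<in> S \<Longrightarrow> z \<in> S \<Longrightarrow> x < y \<Longrightarrow> y < z \<Longrightarrow>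
    d x < 0 \<Longrightarrow> 0 < d y \<Longrightarrow> 0 \<le> d z"
  unfolding humpless_on_def by blast

text \<open>
  As the tails vanish at the end, each sign change of the tails, and the final return to zero,
  forces a sign of the integrand.
\<close>

lemma humpless_on_tail_integral:
  fixes d :: "real \<Rightarrow> real"
  assumes humpless_d: "humpless_on {c..} d" and int: "d integrable_on {c..M}"
  shows "humpless_on {c..} (\<lambda>u. integral {u..M} d)"
proof (rule humpless_onI)
  fix x y z :: real
  let ?D = "\<lambda>u. integral {u..M} d"
  assume xyz: "x \<in> {c..}" "y \<in> {c..}" "z \<in> {c..}" "x < y" "y < z"
    and signs: "?D x < 0" "0 < ?D y" "?D z < 0"
  then have "z \<le> M"
    by (cases "z \<le> M") auto
  have int_sub: "d integrable_on {u..v}" if "c \<le> u" "v \<le> M" for u v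
    using integrable_subinterval_real[OF int] that by auto
  have diff: "?D u - ?D v = integral {u..v} d" if "c \<le> u" "u \<le> v" "v \<le> M" for u v
    using Henstock_Kurzweil_Integration.integral_combine[OF that(2,3) int_sub[OF that(1)]] by simp
  have "integral {x..y} d < 0" "0 < integral {y..z} d"
    using diff[of x y] diff[of y z] signs xyz \<open>z \<le> M\<close> by auto
  then obtain t1 t2 where signs_t1_t2: "t1 \<in> {x..y}" "d t1 < 0" "t2 \<in> {y..z}" "0 < d t2"
    using integral_neg_imp_ex_neg[OF int_sub] integral_pos_imp_ex_pos[OF int_sub] xyz \<open>z \<le> M\<close>
    by (metis atLeast_iff less_imp_le order_trans)
  obtain t3 where sign_t3: "t3 \<in> {z..M}" "d t3 < 0"
    using integral_neg_imp_ex_neg[OF int_sub signs(3)] xyz by auto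
  have "t1 \<noteq> t2" "t2 \<noteq> t3"
    using signs_t1_t2 sign_t3 by auto
  then have "0 \<le> d t3"
    using signs_t1_t2 sign_t3 xyz by (intro humpless_onD[OF humpless_d, of t1 t2 t3]) auto
  with sign_t3 show False
    by simp
qed

definition shape_le :: "(real \<Rightarrow> real) \<Rightarrow> (real \<Rightarrow> real) \<Rightarrow> bool" where
  "shape_le f g \<longleftrightarrow> (\<forall>a>0. \<forall>b>0. humpless_on {0..} (\<lambda>x. g x - b * f (x / a)))"

lemma shape_leI:
  assumes "\<And>a b x y z. 0 < a \<Longrightarrow> 0 < b \<Longrightarrow> 0 \<le> x \<Longrightarrow> x < y \<Longrightarrow> y < z \<Longrightarrow> g x < b * f (x / a) \<Longrightarrow>
    b * f (y / a) < g y \<Longrightarrow> g z < b * f (z / a) \<Longrightarrow> False"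
  shows "shape_le f g"
  unfolding shape_le_def by (intro allI impI humpless_onI) (auto intro: assms)

lemma shape_leD:
  assumes "shape_le f g" "0 < a" "0 < b" "0 \<le> x" "x < y" "y < z"
    and "g x < b * f (x / a)" "b * f (y / a) < g y"
  shows "b * f (z / a) \<le> g z"
  using assms humpless_onD[of "{0..}" "\<lambda>x. g x - b * f (x / a)" x y z] by (simp add: shape_le_def)

lemma shape_le_divide:
  assumes shape_le_fg: "shape_le f g" and "0 < C" "0 < c"
  shows "shape_le (\<lambda>x. f x / C) (\<lambda>x. g x / c)"
proof (rule shape_leI)
  fix a b x y z :: real
  assume "0 < a" "0 < b" "0 \<le> x" "x < y" "y < z" "g x / c < b * (f (x / a) / C)"
    "b * (f (y / a) / C) < g y / c" and gz: "g z / c < b * (f (z / a) / C)"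
  then have "b * c / C * f (z / a) \<le> g z"
    using assms
    by (intro shape_leD[OF shape_le_fg, of a "b * c / C" x y z]) (auto simp: field_simps)
  with gz show False
    using assms by (simp add: field_simps)
qed

lemma shape_le_tail_integral:
  fixes p q :: "real \<Rightarrow> real"
  assumes p: "\<And>a b. p integrable_on {a..b}" "\<And>t. M < t \<Longrightarrow> p t = 0"
    and q: "\<And>a b. q integrable_on {a..b}" "\<And>t. M < t \<Longrightarrow> q t = 0"
    and shape_le_pq: "shape_le p q"
  shows "shape_le (\<lambda>x. integral {x..M} p) (\<lambda>x. integral {x..M} q)"
  unfolding shape_le_def
proof (intro allI impI)
  fix a b :: real
  assume scales: "0 < a" "0 < b"
  define N where "N = max M (a * M)"
  have N: "M \<le> N" "M \<le> N / a"
    using scales by (auto simp: N_def field_simps)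
  define d where "d t = q t - b / a * p (t / a)" for t
  have p_rescaled: "(\<lambda>t. b / a * p (t / a)) integrable_on {u..v}" for u v
    using scales p by (intro integrable_on_mult_right integrable_rescale)
  have tail: "integral {u..N} d = integral {u..M} q - b * integral {u / a..M} p" for u
  proof -
    have "integral {u..N} d = integral {u..N} q - b / a * integral {u..N} (\<lambda>t. p (t / a))"
      unfolding d_def by (simp only: integral_diff[OF q(1) p_rescaled] integral_mult_right)
    also have "\<dots> = integral {u..N} q - b * integral {u / a..N / a} p"
      using scales by (simp add: integral_rescale)
    finally show ?thesis
      by (simp only: integral_extend_upper[OF p(2) N(2)] integral_extend_upper[OF q(2) N(1)])
  qed
  have "humpless_on {0..} d"
    using shape_le_pq scales unfolding shape_le_def d_def by (meson divide_pos_pos)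
  then have "humpless_on {0..} (\<lambda>u. integral {u..N} d)"
    unfolding d_def by (rule humpless_on_tail_integral) (intro integrable_diff q p_rescaled)
  then show "humpless_on {0..} (\<lambda>x. integral {x..M} q - b * integral {x / a..M} p)"
    by (simp add: tail)
qed

lemma pinv0_less_rescaled_imp:
  assumes profile_f: "profile f" and profile_g: "profile g"
    and scales: "0 < a" "0 < b" and t: "0 \<le> t"
    and pinv0_gap: "pinv0 g t < b * pinv0 f (t / a)"
  shows "g (pinv0 g t) < a * f (pinv0 g t / b)"
proof -
  have "t / a < f (pinv0 g t / b)"
    using pinv0_gap scales t pinv0_bounds(1)[OF profile_in_E[OF profile_g]]
    by (intro less_pinv0_imp_less[OF profile_f]) (auto simp: field_simps)
  then show ?thesis
    using profile_apply_pinv0[OF profile_g t] scales by (simp add: field_simps)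
qed

lemma rescaled_less_pinv0_imp:
  assumes profile_f: "profile f" and profile_g: "profile g"
    and scales: "0 < a" "0 < b" and t: "0 < t"
    and pinv0_gap: "b * pinv0 f (t / a) < pinv0 g t"
  shows "a * f (pinv0 g t / b) < g (pinv0 g t)"
proof -
  have "0 \<le> b * pinv0 f (t / a)"
    using scales pinv0_bounds(1)[OF profile_in_E[OF profile_f]] by simp
  then have "t \<le> 1"
    using pinv0_gap pinv0_eq_0[of t g] by fastforce
  moreover have "f (pinv0 g t / b) < t / a"
    using pinv0_gap scales t by (intro pinv0_less_imp_less[OF profile_f]) (auto simp: field_simps)
  ultimately show ?thesis
    using profile_apply_pinv0[OF profile_g, of t] t scales by (simp add: field_simps)
qed

lemma shape_le_pinv0:
  assumes profile_f: "profile f" and profile_g: "profile g" and shape_le_fg: "shape_le f g"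
  shows "shape_le (pinv0 f) (pinv0 g)"
proof (rule shape_leI)
  fix a b x y z :: real
  assume scales: "0 < a" "0 < b" and xyz: "0 \<le> x" "x < y" "y < z"
    and signs: "pinv0 g x < b * pinv0 f (x / a)" "b * pinv0 f (y / a) < pinv0 g y"
      "pinv0 g z < b * pinv0 f (z / a)"
  have x: "g (pinv0 g x) < a * f (pinv0 g x / b)" and z: "g (pinv0 g z) < a * f (pinv0 g z / b)"
    using pinv0_less_rescaled_imp[OF profile_f profile_g scales] signs xyz by auto
  have y: "a * f (pinv0 g y / b) < g (pinv0 g y)"
    using rescaled_less_pinv0_imp[OF profile_f profile_g scales] signs xyz by auto
  have "pinv0 g z \<le> pinv0 g y" "pinv0 g y \<le> pinv0 g x"
    using monotone_onD[OF pinv0_antimono[OF profile_in_E[OF profile_g], of UNIV]] xyz by auto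
  moreover have "pinv0 g z \<noteq> pinv0 g y" "pinv0 g y \<noteq> pinv0 g x"
    using x y z by auto
  ultimately have "a * f (pinv0 g x / b) \<le> g (pinv0 g x)"
    using y z scales pinv0_bounds(1)[OF profile_in_E[OF profile_g]]
    by (intro shape_leD[OF shape_le_fg, of b a "pinv0 g z" "pinv0 g y" "pinv0 g x"]) auto
  with x show False
    by simp
qed

lemma shape_le_Top_pinv0:
  assumes "in_E f" "in_E g" "shape_le (pinv0 f) (pinv0 g)"
  shows "shape_le (Top f) (Top g)"
  unfolding Top_pinv0[abs_def]
  by (intro shape_le_divide shape_le_tail_integral pinv0_integrable pinv0_eq_0
      in_E_integral_pos assms)

lemma shape_le_Top: "profile f \<Longrightarrow> profile g \<Longrightarrow> shape_le f g \<Longrightarrow> shape_le (Top f) (Top g)"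
  by (intro shape_le_Top_pinv0 shape_le_pinv0 profile_in_E)

lemma shape_le_Top_one:
  assumes in_E_f: "in_E f"
  shows "shape_le (Top (\<lambda>_. 1)) (Top f)"
proof (intro shape_le_Top_pinv0 in_E_one in_E_f shape_leI)
  fix a b x y z :: real
  assume scales: "0 < a" "0 < b" and xyz: "0 \<le> x" "x < y" "y < z"
    and signs: "pinv0 f x < b * pinv0 (\<lambda>_. 1) (x / a)" "b * pinv0 (\<lambda>_. 1) (y / a) < pinv0 f y"
      "pinv0 f z < b * pinv0 (\<lambda>_. 1) (z / a)"
  have "z / a \<le> 1"
    using signs(3) pinv0_bounds(1)[OF in_E_f, of z] by (auto simp: pinv0_one split: if_splits)
  then have "x / a \<le> 1" "y / a \<le> 1"
    using scales xyz by (auto simp: field_simps)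
  moreover have "pinv0 f y \<le> pinv0 f x"
    using monotone_onD[OF pinv0_antimono[OF in_E_f, of UNIV]] xyz by simp
  ultimately show False
    using signs by (simp add: pinv0_one)
qed

lemma shape_le_imp_ge:
  assumes profile_f: "profile f" and profile_g: "profile g" and shape_le_fg: "shape_le f g"
    and x: "0 \<le> x"
  shows "g x \<le> f x"
proof (rule ccontr)
  assume exceeds: "\<not> g x \<le> f x"
  have "x \<noteq> 0" "\<not> 1 \<le> x"
    using exceeds profile_0[OF profile_f] profile_0[OF profile_g]
      profile_eq_0[OF profile_f] profile_eq_0[OF profile_g] by auto
  then have x01: "0 < x" "x < 1"
    using x by auto
  have "isCont (\<lambda>b. f (x / b)) 1"
    by (rule isCont_o2[where g=f]) (use profile_isCont[OF profile_f x01] in simp_all)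
  then have "isCont (\<lambda>b. b * f (x / b)) 1"
    by (intro isCont_mult continuous_ident)
  then obtain b where b: "1 < b" "b * f (x / b) < g x"
    using isCont_less_imp_ex_greater[of 1 "\<lambda>b. b * f (x / b)" "g x"] exceeds by auto
  have "b * f (1 / b) \<le> g 1"
    using b x01 profile_0[OF profile_f] profile_0[OF profile_g]
    by (intro shape_leD[OF shape_le_fg, of b b 0 x 1]) auto
  moreover have "0 < b * f (1 / b)"
    using profile_pos[OF profile_f, of "1 / b"] b by simp
  ultimately show False
    using profile_eq_0[OF profile_g, of 1] by simp
qed

lemma slopes_imp_ex_rescaled_less:
  fixes F G :: "real \<Rightarrow> real"
  assumes slope_F: "(F has_real_derivative - \<alpha>) (at_right 0)"
    and slope_G: "(G has_real_derivative - \<beta>) (at_right 0)"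
    and "F 0 = G 0" and a: "0 < a" "\<beta> < \<alpha> / a" and "0 < z"
  shows "\<exists>y. 0 < y \<and> y < z \<and> F (y / a) < G y"
proof -
  have "(\<lambda>y. y / a) ` {0<..} = {0<..}"
  proof
    show "{0<..} \<subseteq> (\<lambda>y. y / a) ` {0<..}"
      using a by (auto intro!: image_eqI[of _ _ "_ * a"])
  qed (use a in auto)
  then have "(F \<circ> (\<lambda>y. y / a) has_real_derivative - \<alpha> * (1 / a)) (at_right 0)"
    using slope_F by (intro DERIV_image_chain DERIV_cdivide DERIV_ident) auto
  then have "((\<lambda>y. G y - F (y / a)) has_real_derivative - \<beta> - - \<alpha> * (1 / a)) (at_right 0)"
    using slope_G by (intro DERIV_diff) (auto simp: o_def)
  from has_real_derivative_pos_inc_right[OF this] obtain \<delta>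
    where \<delta>: "0 < \<delta>" "\<And>h. 0 < h \<Longrightarrow> h < \<delta> \<Longrightarrow> F (h / a) < G h"
    using a \<open>F 0 = G 0\<close> by auto
  then show ?thesis
    using dense[of 0 "min \<delta> z"] \<open>0 < z\<close> by auto
qed

text \<open>
  Scaled up by a factor slightly above 1, the stretched copy of \<open>F\<close> lies above \<open>G\<close> at the origin
  and below \<open>G\<close> shortly after it, so it cannot lie above \<open>G\<close> again further on.
\<close>

lemma shape_le_imp_le_rescaled:
  assumes profile_F: "profile F" and profile_G: "profile G" and shape_le_FG: "shape_le F G"
    and slope_F: "(F has_real_derivative - \<alpha>) (at_right 0)"
    and slope_G: "(G has_real_derivative - \<beta>) (at_right 0)"
    and a: "0 < a" "\<beta> < \<alpha> / a" and z: "0 \<le> z"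
  shows "F (z / a) \<le> G z"
proof (cases "z = 0")
  case False
  have eq_0: "F 0 = G 0"
    using profile_0[OF profile_F] profile_0[OF profile_G] by simp
  obtain y where y: "0 < y" "y < z" "F (y / a) < G y"
    using slopes_imp_ex_rescaled_less[OF slope_F slope_G eq_0 a, of z] z False by auto
  have "isCont (\<lambda>b. b * F (y / a)) 1"
    by (intro continuous_intros)
  then obtain b where b: "1 < b" "b * F (y / a) < G y"
    using isCont_less_imp_ex_greater[of 1 "\<lambda>b. b * F (y / a)" "G y"] y by auto
  have "F (z / a) \<le> b * F (z / a)"
    using b profile_bounds(1)[OF profile_F, of "z / a"] a z by (simp add: mult_le_cancel_right1)
  also have "\<dots> \<le> G z"
    using a b y profile_0[OF profile_F] profile_0[OF profile_G]
    by (intro shape_leD[OF shape_le_FG, of a b 0 y z]) auto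
  finally show ?thesis .
qed (simp add: profile_0[OF profile_F] profile_0[OF profile_G])

lemma shape_le_imp_le_slope_ratio:
  assumes profile_F: "profile F" and profile_G: "profile G" and shape_le_FG: "shape_le F G"
    and slope_F: "(F has_real_derivative - \<alpha>) (at_right 0)"
    and slope_G: "(G has_real_derivative - \<beta>) (at_right 0)"
    and slopes: "0 < \<alpha>" "0 < \<beta>" and x: "0 \<le> x"
  shows "F x \<le> G (\<alpha> / \<beta> * x)"
proof (rule ccontr)
  assume exceeds: "\<not> F x \<le> G (\<alpha> / \<beta> * x)"
  have ratio: "0 \<le> \<alpha> / \<beta> * x"
    using slopes x by simp
  have "x \<noteq> 0" "\<not> 1 \<le> x"
    using exceeds profile_0[OF profile_F] profile_0[OF profile_G]
      profile_eq_0[OF profile_F, of x] profile_bounds(1)[OF profile_G ratio]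
    by auto
  then have x01: "0 < x" "x < 1"
    using x by auto
  have "isCont (\<lambda>s. F (s * x)) 1"
    by (rule isCont_o2[where g=F]) (use profile_isCont[OF profile_F x01] in simp_all)
  then have "isCont (\<lambda>s. - F (s * x)) 1"
    by (rule isCont_minus)
  then obtain s where s: "1 < s" "G (\<alpha> / \<beta> * x) < F (s * x)"
    using isCont_less_imp_ex_greater[of 1 "\<lambda>s. - F (s * x)" "- G (\<alpha> / \<beta> * x)"] exceeds by auto
  have "F (\<alpha> / \<beta> * x / (\<alpha> / (\<beta> * s))) \<le> G (\<alpha> / \<beta> * x)"
    using s slopes ratio
    by (intro shape_le_imp_le_rescaled[OF profile_F profile_G shape_le_FG slope_F slope_G]) auto
  with s show False
    using slopes by (simp add: field_simps)
qed

lemma Top_le_rescaled_Top: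
  assumes profile_f: "profile f" and profile_g: "profile g" and shape_le_fg: "shape_le f g"
    and x: "0 \<le> x"
  shows "Top f x \<le> Top g (integral {0..1} g / integral {0..1} f * x)"
  using shape_le_imp_le_slope_ratio[OF _ _ shape_le_Top[OF profile_f profile_g shape_le_fg]
      Top_has_real_derivative_0[OF profile_f] Top_has_real_derivative_0[OF profile_g] _ _ x]
    in_E_integral_pos[OF profile_in_E[OF profile_f]]
    in_E_integral_pos[OF profile_in_E[OF profile_g]]
  by (simp add: profile_Top profile_in_E profile_continuous_on profile_f profile_g)

section \<open>The iterates of the constant function\<close>

lemma in_E_funpow_Top: "in_E f \<Longrightarrow> in_E ((Top ^^ n) f)"
  by (induction n) (auto intro: in_E_Top)

lemma profile_funpow_Top:
  assumes "in_E f" "continuous_on {0..1} f"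
  shows "profile ((Top ^^ Suc n) f)"
proof (induction n)
  case 0
  then show ?case
    using profile_Top[OF assms] by simp
next
  case (Suc n)
  then show ?case
    using profile_Top[OF profile_in_E profile_continuous_on] by simp
qed

lemma shape_le_hseq_funpow_Top:
  assumes "in_E f" "continuous_on {0..1} f"
  shows "shape_le (hseq (Suc n)) ((Top ^^ Suc n) f)"
proof (induction n)
  case 0
  then show ?case
    using shape_le_Top_one[OF assms(1)] by (simp add: hseq_def)
next
  case (Suc n)
  have "profile ((Top ^^ Suc n) (\<lambda>_. 1))"
    by (intro profile_funpow_Top in_E_one) simp
  then show ?case
    using shape_le_Top[OF _ profile_funpow_Top[OF assms] Suc] by (simp add: hseq_def)
qed

lemma hseq_Suc: "hseq (Suc n) = Top (hseq n)"
  by (simp add: hseq_def)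

lemma profile_hseq: "profile (hseq (Suc n))"
  unfolding hseq_def by (intro profile_funpow_Top in_E_one) simp

lemma hseq_integrable: "hseq (Suc n) integrable_on {0..1}"
  by (intro in_E_integrable profile_in_E profile_hseq)

lemma hseq_Suc_le:
  assumes "0 \<le> x"
  shows "hseq (Suc (Suc n)) x \<le> hseq (Suc n) x"
proof -
  have "hseq (Suc (Suc n)) = (Top ^^ Suc n) (Top (\<lambda>_. 1))"
    by (simp only: hseq_def funpow_Suc_right o_apply)
  then have "shape_le (hseq (Suc n)) (hseq (Suc (Suc n)))"
    by (simp only:) (intro shape_le_hseq_funpow_Top in_E_Top Top_continuous_on in_E_one)
  then show ?thesis
    by (rule shape_le_imp_ge[OF profile_hseq profile_hseq _ assms])
qed

lemma hseq_tendsto_hlim: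
  assumes "0 \<le> x"
  shows "(\<lambda>n. hseq (Suc n) x) \<longlonglongrightarrow> hlim x"
proof -
  have "decseq (\<lambda>n. hseq (Suc n) x)"
    by (rule decseq_SucI) (rule hseq_Suc_le[OF assms])
  then obtain l where l: "(\<lambda>n. hseq (Suc n) x) \<longlonglongrightarrow> l"
    using decseq_convergent[of _ 0] profile_bounds(1)[OF profile_hseq assms] by blast
  moreover have "hlim x = l"
    unfolding hlim_def by (intro limI LIMSEQ_imp_Suc[OF l])
  ultimately show ?thesis
    by simp
qed

lemma
  shows hlim_integrable: "hlim integrable_on {0..1}"
    and integral_hseq_tendsto: "(\<lambda>n. integral {0..1} (hseq (Suc n))) \<longlonglongrightarrow> integral {0..1} hlim"
proof -
  have "norm (integral {0..1} (hseq (Suc n))) \<le> 1" for n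
    using integral_le[OF hseq_integrable, of "\<lambda>_. 1" n] profile_bounds[OF profile_hseq, of _ n]
      integral_nonneg[OF hseq_integrable, of n] by auto
  then have "bounded (range (\<lambda>n. integral {0..1} (hseq (Suc n))))"
    by (auto simp: bounded_iff)
  then have "hlim integrable_on {0..1} \<and>
      (\<lambda>n. integral {0..1} (hseq (Suc n))) \<longlonglongrightarrow> integral {0..1} hlim"
    by (intro monotone_convergence_decreasing hseq_integrable hseq_Suc_le hseq_tendsto_hlim) auto
  then show "hlim integrable_on {0..1}"
    and "(\<lambda>n. integral {0..1} (hseq (Suc n))) \<longlonglongrightarrow> integral {0..1} hlim"
    by auto
qed

definition shape_above_hseq :: "(real \<Rightarrow> real) \<Rightarrow> bool" where
  "shape_above_hseq g \<longleftrightarrow> profile g \<and> (\<forall>n. shape_le (hseq (Suc n)) g)"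

lemma shape_above_hseq_profile: "shape_above_hseq g \<Longrightarrow> profile g"
  by (simp add: shape_above_hseq_def)

lemma shape_above_hseq_Top:
  assumes "shape_above_hseq g"
  shows "shape_above_hseq (Top g)"
proof -
  have profile_g: "profile g"
    by (rule shape_above_hseq_profile[OF assms])
  have "shape_le (hseq (Suc n)) (Top g)" for n
  proof (cases n)
    case 0
    then show ?thesis
      using shape_le_Top_one[OF profile_in_E[OF profile_g]] by (simp add: hseq_def)
  next
    case (Suc m)
    then show ?thesis
      using shape_le_Top[OF profile_hseq profile_g, of m] assms
      by (simp add: shape_above_hseq_def hseq_Suc)
  qed
  then show ?thesis
    using profile_g
    by (simp add: shape_above_hseq_def profile_Top profile_in_E profile_continuous_on)
qed

lemma shape_above_hseq_le_hseq: "shape_above_hseq g \<Longrightarrow> 0 \<le> x \<Longrightarrow> g x \<le> hseq (Suc n) x"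
  by (rule shape_le_imp_ge[OF profile_hseq]) (simp_all add: shape_above_hseq_def)

lemma shape_above_hseq_le_hlim: "shape_above_hseq g \<Longrightarrow> 0 \<le> x \<Longrightarrow> g x \<le> hlim x"
  using LIMSEQ_le_const[OF hseq_tendsto_hlim] shape_above_hseq_le_hseq by blast

definition hlim_ratio :: "(real \<Rightarrow> real) \<Rightarrow> real" where
  "hlim_ratio g = integral {0..1} g / integral {0..1} hlim"

lemma shape_above_hseq_hlim_ratio:
  assumes "shape_above_hseq g"
  shows "0 < hlim_ratio g" "hlim_ratio g \<le> 1"
proof -
  have in_E_g: "in_E g"
    by (intro profile_in_E shape_above_hseq_profile assms)
  have "integral {0..1} g \<le> integral {0..1} hlim"
    by (intro integral_le in_E_integrable in_E_g hlim_integrable shape_above_hseq_le_hlim assms)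
      simp
  then show "0 < hlim_ratio g"
    and "hlim_ratio g \<le> 1"
    using in_E_integral_pos[OF in_E_g] by (simp_all add: hlim_ratio_def)
qed

lemma hlim_le_rescaled_Top:
  assumes above_g: "shape_above_hseq g" and x: "x \<in> {0..1}"
  shows "hlim x \<le> Top g (hlim_ratio g * x)"
proof (rule LIMSEQ_le)
  let ?ratio = "\<lambda>n. integral {0..1} g / integral {0..1} (hseq (Suc n))"
  have in_E_g: "in_E g"
    by (intro profile_in_E shape_above_hseq_profile above_g)
  show "(\<lambda>n. hseq (Suc (Suc n)) x) \<longlonglongrightarrow> hlim x"
    using LIMSEQ_Suc[OF hseq_tendsto_hlim[of x]] x by simp
  have scaled_in_Icc: "c * x \<in> {0..1}" if "0 < c" "c \<le> 1" for c
    using that x mult_le_one[of c x] by simp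
  have "?ratio n * x \<in> {0..1}" for n
  proof -
    have "integral {0..1} g \<le> integral {0..1} (hseq (Suc n))"
      by (intro integral_le in_E_integrable in_E_g hseq_integrable
          shape_above_hseq_le_hseq above_g) simp
    then show ?thesis
      using in_E_integral_pos[OF in_E_g] in_E_integral_pos[OF profile_in_E[OF profile_hseq[of n]]]
      by (intro scaled_in_Icc) simp_all
  qed
  moreover have "hlim_ratio g * x \<in> {0..1}"
    by (intro scaled_in_Icc shape_above_hseq_hlim_ratio above_g)
  moreover have "(\<lambda>n. ?ratio n * x) \<longlonglongrightarrow> hlim_ratio g * x"
    using shape_above_hseq_hlim_ratio(1)[OF above_g] unfolding hlim_ratio_def
    by (intro tendsto_intros integral_hseq_tendsto) auto
  ultimately show "(\<lambda>n. Top g (?ratio n * x)) \<longlonglongrightarrow> Top g (hlim_ratio g * x)"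
    by (intro continuous_on_tendsto_compose[OF Top_continuous_on[OF in_E_g]]) auto
  show "\<exists>N. \<forall>n\<ge>N. hseq (Suc (Suc n)) x \<le> Top g (?ratio n * x)"
    using Top_le_rescaled_Top[OF profile_hseq, of g] above_g x
    by (auto simp: shape_above_hseq_def hseq_Suc)
qed

lemma integral_le_initial_integral_Top:
  assumes above_g: "shape_above_hseq g"
  shows "integral {0..1} g \<le> integral {0..hlim_ratio g} (Top g)"
proof -
  define \<rho> where "\<rho> = hlim_ratio g"
  have ratio: "0 < \<rho>" "\<rho> \<le> 1"
    using shape_above_hseq_hlim_ratio[OF above_g] by (simp_all add: \<rho>_def)
  have "in_E (Top g)"
    by (intro profile_in_E shape_above_hseq_profile shape_above_hseq_Top above_g)
  then have int: "Top g integrable_on {0..\<rho>}"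
    using integrable_subinterval_real[OF in_E_integrable] ratio by auto
  have "integral {0..1} g = \<rho> * integral {0..1} hlim"
    using ratio by (auto simp: \<rho>_def hlim_ratio_def)
  also have "\<dots> = integral {0..\<rho>} (\<lambda>t. hlim (t / \<rho>))"
    using integral_rescale[OF ratio(1), of 0 \<rho> hlim] ratio by simp
  also have "\<dots> \<le> integral {0..\<rho>} (Top g)"
  proof (intro integral_le int integrable_rescale ratio)
    show "hlim (t / \<rho>) \<le> Top g t" if "t \<in> {0..\<rho>}" for t
      using hlim_le_rescaled_Top[OF above_g, of "t / \<rho>"] ratio that by (simp flip: \<rho>_def)
  qed (use ratio hlim_integrable in simp)
  finally show ?thesis
    by (simp add: \<rho>_def)
qed

lemma initial_integral_Top_less:
  assumes "shape_above_hseq g" "0 \<le> u" "u < 1"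
  shows "integral {0..u} (Top g) < integral {0..1} (Top g)"
  by (intro profile_integral_initial_less shape_above_hseq_profile shape_above_hseq_Top assms)

lemma integral_le_integral_Top:
  assumes above_g: "shape_above_hseq g"
  shows "integral {0..1} g \<le> integral {0..1} (Top g)"
proof -
  note integral_le_initial_integral_Top[OF above_g]
  also have "integral {0..hlim_ratio g} (Top g) \<le> integral {0..1} (Top g)"
    using initial_integral_Top_less[OF above_g, of "hlim_ratio g"]
      shape_above_hseq_hlim_ratio[OF above_g]
    by (cases "hlim_ratio g = 1") simp_all
  finally show ?thesis .
qed

lemma Top_eq_hlim:
  assumes above_g: "shape_above_hseq g"
    and integral_Top_le: "integral {0..1} (Top g) \<le> integral {0..1} g"
    and x: "x \<in> {0..1}"
  shows "Top g x = hlim x"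
proof (rule antisym)
  have "integral {0..1} (Top g) \<le> integral {0..hlim_ratio g} (Top g)"
    using integral_Top_le integral_le_initial_integral_Top[OF above_g] by simp
  then have "hlim_ratio g = 1"
    using initial_integral_Top_less[OF above_g, of "hlim_ratio g"]
      shape_above_hseq_hlim_ratio[OF above_g]
    by (cases "hlim_ratio g = 1") simp_all
  then show "hlim x \<le> Top g x"
    using hlim_le_rescaled_Top[OF above_g x] by simp
  show "Top g x \<le> hlim x"
    using x by (intro shape_above_hseq_le_hlim shape_above_hseq_Top above_g) simp
qed

section \<open>Periodic points\<close>

lemma funpow_Top_add_period:
  assumes period: "\<forall>x\<in>{0..1}. (Top ^^ r) g x = g x" and "0 < i"
  shows "(Top ^^ (i + k * r)) g = (Top ^^ i) g"
proof (induction k)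
  case (Suc k)
  obtain j where j: "i = Suc j"
    using \<open>0 < i\<close> gr0_implies_Suc by blast
  then have "i + Suc k * r = (j + k * r) + Suc r"
    by simp
  then have "(Top ^^ (i + Suc k * r)) g = (Top ^^ (j + k * r)) (Top ((Top ^^ r) g))"
    by (simp only: funpow_add funpow.simps(2) o_apply)
  also have "Top ((Top ^^ r) g) = Top g"
    using period by (intro Top_cong) simp
  also have "(Top ^^ (j + k * r)) (Top g) = (Top ^^ (i + k * r)) g"
    by (simp only: j add_Suc funpow_Suc_right o_apply)
  finally show ?case
    using Suc.IH by simp
qed simp

lemma shape_above_hseq_periodic_orbit:
  assumes "in_E g" and period: "\<forall>x\<in>{0..1}. (Top ^^ r) g x = g x" and "1 \<le> r" "2 \<le> i"
  shows "shape_above_hseq ((Top ^^ i) g)"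
proof -
  have iterate: "in_E ((Top ^^ Suc j) g)" "continuous_on {0..1} ((Top ^^ Suc j) g)" for j
    using in_E_funpow_Top[OF assms(1), of j] by (simp_all add: in_E_Top Top_continuous_on)
  obtain j where j: "i = Suc (Suc j)"
    using \<open>2 \<le> i\<close> by (metis add_2_eq_Suc le_Suc_ex)
  have "profile ((Top ^^ i) g)"
    using profile_Top[OF iterate[of j]] by (simp add: j)
  moreover have "shape_le (hseq (Suc n)) ((Top ^^ i) g)" for n
  proof -
    have "n \<le> n * r"
      using \<open>1 \<le> r\<close> by simp
    then obtain m where "n * r = n + m"
      using le_Suc_ex by blast
    then have "(Top ^^ i) g = (Top ^^ (Suc n + Suc (j + m))) g"
      using funpow_Top_add_period[OF period, of i n] by (simp add: j add_ac)
    also have "\<dots> = (Top ^^ Suc n) ((Top ^^ Suc (j + m)) g)"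
      by (simp only: funpow_add o_apply)
    finally show ?thesis
      by (simp only: shape_le_hseq_funpow_Top[OF iterate])
  qed
  ultimately show ?thesis
    by (simp add: shape_above_hseq_def)
qed

theorem theorem4p9:
  fixes r :: nat and g :: "real \<Rightarrow> real"
  assumes "r \<ge> 1"
    and "in_E g"
    and "\<forall>x\<in>{0..1}. (Top ^^ r) g x = g x"
  shows "\<forall>x\<in>{0..1}. g x = hlim x"
proof
  fix x :: real
  assume x: "x \<in> {0..1}"
  define i where "i = 3 * r - 1"
  have above: "shape_above_hseq ((Top ^^ (i + k)) g)" for k
    using assms by (intro shape_above_hseq_periodic_orbit) (auto simp: i_def)
  have "incseq (\<lambda>k. integral {0..1} ((Top ^^ (i + k)) g))"
    using integral_le_integral_Top[OF above] by (intro incseq_SucI) simp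
  then have "integral {0..1} ((Top ^^ (i + 1)) g) \<le> integral {0..1} ((Top ^^ (i + r)) g)"
    using \<open>r \<ge> 1\<close> by (rule incseqD)
  moreover have "(Top ^^ (i + r)) g = (Top ^^ i) g"
    using funpow_Top_add_period[OF assms(3), of i 1] \<open>r \<ge> 1\<close> by (simp add: i_def)
  ultimately have "Top ((Top ^^ i) g) x = hlim x"
    using above[of 0] x by (intro Top_eq_hlim) simp_all
  moreover have "Suc i = r + 2 * r"
    using \<open>r \<ge> 1\<close> by (simp add: i_def)
  then have "Top ((Top ^^ i) g) = (Top ^^ (r + 2 * r)) g"
    by (metis funpow.simps(2) o_apply)
  moreover have "(Top ^^ (r + 2 * r)) g = (Top ^^ r) g"
    using \<open>r \<ge> 1\<close> by (intro funpow_Top_add_period[OF assms(3)]) simp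
  ultimately show "g x = hlim x"
    using assms(3) x by simp
qed

end
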